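(* Let $K\ge 1$, let $C_1,\dots,C_K:[0,1]^2\to[0,1]$ be bivariate copulas, and for $k\in\{1,\dots,K\}$, $j\in\{1,2\}$ let $g_j^{(k)}:[0,1]\to[0,1]$ be increasing functions with $g_j^{(k)}(0)=0$, $g_j^{(k)}(1)=1$, and such that $\prod_{k=1}^K g_j^{(k)}(u)=u$ for all $u\in[0,1]$ and $j\in\{1,2\}$. Let $\tilde C$ be the (Liebscher) copula $$\tilde C(u,v)=\prod_{k=1}^K C_k\big(g_1^{(k)}(u),g_2^{(k)}(v)\big),\qquad (u,v)\in[0,1]^2,$$ and let $(x,y)\in\mathbb{R}_+^2$. (i) (Lower tail, symmetric case.) Assume that for all $k\in\{1,\dots,K\}$, $g_1^{(k)}=g_2^{(k)}$ is a regularly varying function (at the origin) with index $\gamma^{(k)}>0$. Then $$\Lambda_L(\tilde C;x,y)=\prod_{k=1}^K\Lambda_L\big(C_k;x^{\gamma^{(k)}},y^{\gamma^{(k)}}\big)$$ and, necessarily, $\sum_{k=1}^K\gamma^{(k)}=1$. (ii) (Lower tail, asymmetric case.) Suppose there exists $k_0\in\{1,\dots,K\}$ such that $g_1^{(k_0)}(\varepsilon)/g_2^{(k_0)}(\varepsilon)\to0$ as $\varepsilon\to0$. Then $\Lambda_L(\tilde C;x,y)=0$. (iii) (Upper tail, general case.) Assume that for all $k\in\{1,\dots,K\}$, $g_1^{(k)}$ and $g_2^{(k)}$ are differentiable at $1$, with derivatives at $1$ denoted by $d_1^{(k)}$ and $d_2^{(k)}$ respectively. Then $$\Lambda_U(\tilde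 C;x,y)=\sum_{k=1}^K\Lambda_U\big(C_k;d_1^{(k)}x,d_2^{(k)}y\big)$$ and, necessarily, $\sum_{k=1}^K d_j^{(k)}=1$ for $j\in\{1,2\}$. (iv) (Upper tail, particular case.) If, in addition to the assumptions of (iii), $d_1^{(k)}=d_2^{(k)}=:d^{(k)}$ for all $k\in\{1,\dots,K\}$, then $$\Lambda_U(\tilde C;x,y)=\sum_{k=1}^K d^{(k)}\,\Lambda_U(C_k;x,y)$$ and, necessarily, $\sum_{k=1}^K d^{(k)}=1$.
   Context: For a bivariate copula $C$ and $(x,y)\in\mathbb{R}_+^2=[0,\infty)^2$, the lower and upper tail dependence functions are $$\Lambda_L(C;x,y)=\lim_{\varepsilon\to0^+}\frac{C(\varepsilon x,\varepsilon y)}{\varepsilon},\qquad \Lambda_U(C;x,y)=x+y+\lim_{\varepsilon\to0^+}\frac{C(1-\varepsilon x,1-\varepsilon y)-1}{\varepsilon}.$$ Whenever $\Lambda_L(C_k;\cdot,\cdot)$ or $\Lambda_U(C_k;\cdot,\cdot)$ appears on the right-hand side of a formula, the corresponding limits are assumed to exist for all arguments in $\mathbb{R}_+^2$; the statements include that the limit defining the left-hand side exists. A function $g:[0,1]\to[0,1]$, positive on $(0,1]$, is regularly varying at the origin with index $\gamma$ if $g(\varepsilon t)/g(\varepsilon)\to t^\gamma$ as $\varepsilon\to0^+$ for all $t>0$. Differentiability at $1$ is one-sided (from the left). "Increasing" is understood in the non-strict sense. *)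

theory Defs
  imports Complex_Main
begin

text \<open>
  Functions on the unit interval or unit square are total functions on the reals; only their
  values for arguments in [0, 1] are constrained.
\<close>

definition bivariate_copula :: "(real \<Rightarrow> real \<Rightarrow> real) \<Rightarrow> bool" where
  "bivariate_copula C \<longleftrightarrow>
     (\<forall>u\<in>{0..1}. \<forall>v\<in>{0..1}. C u v \<in> {0..1}) \<and>
     (\<forall>u\<in>{0..1}. C u 0 = 0 \<and> C 0 u = 0) \<and>
     (\<forall>u\<in>{0..1}. C u 1 = u \<and> C 1 u = u) \<and>
     (\<forall>u\<in>{0..1}. \<forall>u'\<in>{0..1}. \<forall>v\<in>{0..1}. \<forall>v'\<in>{0..1}.
        u \<le> u' \<longrightarrow> v \<le> v' \<longrightarrow> C u' v' - C u' v - C u v' + C u v \<ge> 0)"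

text \<open>
  \<open>Lim\<close> is unspecified when the limit does not exist, so existence is a separate
  predicate. For nonnegative \<open>x\<close>, \<open>y\<close> and small positive \<open>\<epsilon>\<close> all arguments of \<open>C\<close> lie in
  [0, 1], so the limits do not depend on values of \<open>C\<close> outside the unit square.
\<close>

definition lower_tail_exists :: "(real \<Rightarrow> real \<Rightarrow> real) \<Rightarrow> real \<Rightarrow> real \<Rightarrow> bool" where
  "lower_tail_exists C x y \<longleftrightarrow>
     (\<exists>l. ((\<lambda>\<epsilon>. C (\<epsilon> * x) (\<epsilon> * y) / \<epsilon>) \<longlongrightarrow> l) (at_right 0))"

definition Lambda_L :: "(real \<Rightarrow> real \<Rightarrow> real) \<Rightarrow> real \<Rightarrow> real \<Rightarrow> real" where
  "Lambda_L C x y = Lim (at_right 0) (\<lambda>\<epsilon>. C (\<epsilon> * x) (\<epsilon> * y) / \<epsilon>)"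

definition upper_tail_exists :: "(real \<Rightarrow> real \<Rightarrow> real) \<Rightarrow> real \<Rightarrow> real \<Rightarrow> bool" where
  "upper_tail_exists C x y \<longleftrightarrow>
     (\<exists>l. ((\<lambda>\<epsilon>. (C (1 - \<epsilon> * x) (1 - \<epsilon> * y) - 1) / \<epsilon>) \<longlongrightarrow> l) (at_right 0))"

definition Lambda_U :: "(real \<Rightarrow> real \<Rightarrow> real) \<Rightarrow> real \<Rightarrow> real \<Rightarrow> real" where
  "Lambda_U C x y =
     x + y + Lim (at_right 0) (\<lambda>\<epsilon>. (C (1 - \<epsilon> * x) (1 - \<epsilon> * y) - 1) / \<epsilon>)"

definition regularly_varying_at_0 :: "(real \<Rightarrow> real) \<Rightarrow> real \<Rightarrow> bool" where
  "regularly_varying_at_0 g \<gamma> \<longleftrightarrow>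
     g ` {0..1} \<subseteq> {0..1} \<and> (\<forall>u\<in>{0<..1}. g u > 0) \<and>
     (\<forall>t>0. ((\<lambda>\<epsilon>. g (\<epsilon> * t) / g \<epsilon>) \<longlongrightarrow> t powr \<gamma>) (at_right 0))"

definition liebscher ::
  "nat \<Rightarrow> (nat \<Rightarrow> real \<Rightarrow> real \<Rightarrow> real) \<Rightarrow> (nat \<Rightarrow> nat \<Rightarrow> real \<Rightarrow> real) \<Rightarrow> real \<Rightarrow> real \<Rightarrow> real" where
  "liebscher K C g u v = (\<Prod>k=1..K. C k (g 1 k u) (g 2 k v))"

end

theory Submission
  imports Defs
begin

text \<open>
  Everything rests on two elementary facts about a bivariate copula \<open>C\<close>: it is bounded by each
  of its arguments, and it is Lipschitz, \<open>\<bar>C u v - C u' v'\<bar> \<le> \<bar>u - u'\<bar> + \<bar>v - v'\<bar>\<close>. A tail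
  dependence function is, up to linear terms, a directional derivative of \<open>C\<close> at a corner of the
  unit square, and the
  Lipschitz property makes such a derivative insensitive to errors of smaller order in the
  arguments and to the speed at which the corner is approached: if \<open>D (\<epsilon> s) (\<epsilon> t) / \<epsilon>\<close> tends
  to \<open>l\<close>, then so does \<open>D (h a) (h b) / h\<close> whenever \<open>h\<close> tends to \<open>0\<close> from
  the right, \<open>a\<close> tends to \<open>s\<close>
  and \<open>b\<close> tends to \<open>t\<close> (lemma \<open>corner_limit_perturb\<close>, used with \<open>D\<close> the copula at the lower
  corner and with \<open>D u v = C (1 - u) (1 - v) - 1\<close> at the upper one).

  Lower tail, symmetric case. Write \<open>L\<close> for the Liebscher copula and \<open>g\<^sup>k\<close> for the common
  generators. As the product of the \<open>g\<^sup>k \<epsilon>\<close> is \<open>\<epsilon>\<close>, the quotient \<open>L (\<epsilon> x) (\<epsilon> y) / \<epsilon>\<close>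
  is the product of the \<open>C\<^sub>k (g\<^sup>k (\<epsilon> x)) (g\<^sup>k (\<epsilon> y)) / g\<^sup>k \<epsilon>\<close>. With
  \<open>h = g\<^sup>k\<close>, the perturbation lemma gives the limit of each factor, since regular variation says
  that \<open>g\<^sup>k (\<epsilon> x) / g\<^sup>k \<epsilon>\<close> tends to \<open>x powr \<gamma>\<^sup>k\<close>; a positive index forces \<open>g\<^sup>k\<close> to vanish
  continuously at \<open>0\<close> (lemma \<open>regularly_varying_tendsto_0\<close>). Taking the product of
  \<open>g\<^sup>k (2 \<epsilon>) / g\<^sup>k \<epsilon>\<close> over \<open>k\<close> shows that \<open>2\<close> raised to the sum of the indices is \<open>2\<close>.

  Lower tail, asymmetric case. Bound the \<open>k\<^sub>0\<close>-th copula by its first argument and the others by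
  their second one. The product of these bounds at \<open>\<epsilon> m\<close> is \<open>\<epsilon> m\<close> times the ratio of the two
  generators at \<open>\<epsilon> m\<close>, which is of smaller order than \<open>\<epsilon>\<close>.

  Upper tail. Each factor, as a function of \<open>\<epsilon>\<close>, has value \<open>1\<close> at \<open>0\<close> and, by the perturbation
  lemma with \<open>h \<epsilon> = \<epsilon>\<close>, a right derivative there. By the product rule these derivatives add
  up, and the product rule at \<open>1\<close> for the identity written as the product of the generators
  shows that the derivatives of the generators sum to \<open>1\<close>, which accounts for the linear terms.
  The case of equal derivatives follows because the upper tail dependence function is positively
  homogeneous.
\<close>

section \<open>Copulas\<close>

lemma copula_rectangle:
  assumes "bivariate_copula C" "u \<in> {0..1}" "u' \<in> {0..1}" "v \<in> {0..1}" "v' \<in> {0..1}"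
    and "u \<le> u'" "v \<le> v'"
  shows "C u' v' - C u' v - C u v' + C u v \<ge> 0"
  using assms unfolding bivariate_copula_def by blast

lemma copula_margins:
  assumes "bivariate_copula C" "u \<in> {0..1}"
  shows "C u 0 = 0" "C 0 u = 0" "C u 1 = u" "C 1 u = u"
  using assms unfolding bivariate_copula_def by blast+

lemma copula_nonneg:
  assumes "bivariate_copula C" "u \<in> {0..1}" "v \<in> {0..1}"
  shows "C u v \<ge> 0"
proof -
  have "C u v \<in> {0..1}"
    using assms unfolding bivariate_copula_def by blast
  then show ?thesis
    by simp
qed

text \<open>
  The increment in one argument is the mass of a vertical or horizontal strip. Nonnegativity of
  the mass below the level \<open>v\<close> gives monotonicity, and nonnegativity of the mass above it bounds
  the increment by that of the uniform margin.
\<close>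

lemma copula_increment_fst:
  assumes C: "bivariate_copula C" and u: "u \<in> {0..1}" "u' \<in> {0..1}" "u \<le> u'" and v: "v \<in> {0..1}"
  shows "0 \<le> C u' v - C u v" "C u' v - C u v \<le> u' - u"
  using copula_rectangle[OF C u(1,2), of 0 v] copula_rectangle[OF C u(1,2), of v 1]
    copula_margins[OF C u(1)] copula_margins[OF C u(2)] u v by auto

lemma copula_increment_snd:
  assumes C: "bivariate_copula C" and v: "v \<in> {0..1}" "v' \<in> {0..1}" "v \<le> v'" and u: "u \<in> {0..1}"
  shows "0 \<le> C u v' - C u v" "C u v' - C u v \<le> v' - v"
  using copula_rectangle[OF C _ _ v(1,2), of 0 u] copula_rectangle[OF C _ _ v(1,2), of u 1]
    copula_margins[OF C v(1)] copula_margins[OF C v(2)] u v by auto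

lemma copula_le_fst:
  assumes C: "bivariate_copula C" and u: "u \<in> {0..1}" and v: "v \<in> {0..1}"
  shows "C u v \<le> u"
  using copula_increment_snd(1)[OF C v _ _ u, of 1] copula_margins[OF C u] v by auto

lemma copula_le_snd:
  assumes C: "bivariate_copula C" and u: "u \<in> {0..1}" and v: "v \<in> {0..1}"
  shows "C u v \<le> v"
  using copula_increment_fst(1)[OF C u _ _ v, of 1] copula_margins[OF C v] u by auto

definition unit_square_lipschitz :: "(real \<Rightarrow> real \<Rightarrow> real) \<Rightarrow> bool" where
  "unit_square_lipschitz D \<longleftrightarrow>
     (\<forall>u\<in>{0..1}. \<forall>u'\<in>{0..1}. \<forall>v\<in>{0..1}. \<forall>v'\<in>{0..1}.
        \<bar>D u v - D u' v'\<bar> \<le> \<bar>u - u'\<bar> + \<bar>v - v'\<bar>)"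

lemma copula_lipschitz:
  assumes C: "bivariate_copula C"
  shows "unit_square_lipschitz C"
  unfolding unit_square_lipschitz_def
proof (intro ballI)
  fix u u' v v' :: real
  assume u: "u \<in> {0..1}" "u' \<in> {0..1}" and v: "v \<in> {0..1}" "v' \<in> {0..1}"
  have "\<bar>C u v - C u' v\<bar> \<le> \<bar>u - u'\<bar>"
    using copula_increment_fst[OF C u _ v(1)] copula_increment_fst[OF C u(2,1) _ v(1)]
    by (cases "u \<le> u'") auto
  moreover have "\<bar>C u' v - C u' v'\<bar> \<le> \<bar>v - v'\<bar>"
    using copula_increment_snd[OF C v _ u(2)] copula_increment_snd[OF C v(2,1) _ u(2)]
    by (cases "v \<le> v'") auto
  ultimately show "\<bar>C u v - C u' v'\<bar> \<le> \<bar>u - u'\<bar> + \<bar>v - v'\<bar>"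
    by linarith
qed

lemma copula_reflected_lipschitz:
  assumes C: "bivariate_copula C"
  shows "unit_square_lipschitz (\<lambda>u v. C (1 - u) (1 - v) - 1)"
  unfolding unit_square_lipschitz_def
proof (intro ballI)
  fix u u' v v' :: real
  assume "u \<in> {0..1}" "u' \<in> {0..1}" "v \<in> {0..1}" "v' \<in> {0..1}"
  then have "\<bar>C (1 - u) (1 - v) - C (1 - u') (1 - v')\<bar>
      \<le> \<bar>(1 - u) - (1 - u')\<bar> + \<bar>(1 - v) - (1 - v')\<bar>"
    by (intro copula_lipschitz[OF C, unfolded unit_square_lipschitz_def, rule_format]) auto
  then show "\<bar>(C (1 - u) (1 - v) - 1) - (C (1 - u') (1 - v') - 1)\<bar> \<le> \<bar>u - u'\<bar> + \<bar>v - v'\<bar>"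
    by linarith
qed

section \<open>Limits at a corner of the unit square\<close>

lemma filterlim_times_at_right_0:
  fixes c :: real
  assumes "c > 0"
  shows "filterlim (\<lambda>\<epsilon>. \<epsilon> * c) (at_right 0) (at_right 0)"
  unfolding filterlim_at
proof
  show "\<forall>\<^sub>F \<epsilon> in at_right 0. \<epsilon> * c \<in> {0<..} \<and> \<epsilon> * c \<noteq> 0"
    using eventually_at_right_less[of 0] by eventually_elim (use assms in auto)
  show "((\<lambda>\<epsilon>. \<epsilon> * c) \<longlongrightarrow> 0) (at_right 0)"
    by (auto intro!: tendsto_eq_intros)
qed

lemma eventually_times_in_unit:
  fixes x :: real
  assumes "x \<ge> 0"
  shows "\<forall>\<^sub>F \<epsilon> in at_right 0. \<epsilon> * x \<in> {0..1}"
proof -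
  have "((\<lambda>\<epsilon>. \<epsilon> * x) \<longlongrightarrow> 0) (at_right 0)"
    by (auto intro!: tendsto_eq_intros)
  then have "\<forall>\<^sub>F \<epsilon> in at_right 0. \<epsilon> * x < 1"
    by (rule order_tendstoD) simp
  with eventually_at_right_less[of 0] show ?thesis
    by eventually_elim (use assms in auto)
qed

text \<open>
  The Lipschitz bound, divided by \<open>h\<close>, controls the change from the exact direction \<open>(s, t)\<close> to
  the perturbed direction \<open>(a, b)\<close> by \<open>\<bar>a - s\<bar> + \<bar>b - t\<bar>\<close>.
\<close>

lemma corner_limit_perturb:
  fixes h a b :: "'a \<Rightarrow> real"
  assumes D: "unit_square_lipschitz D"
    and lim: "((\<lambda>\<epsilon>. D (\<epsilon> * s) (\<epsilon> * t) / \<epsilon>) \<longlongrightarrow> l) (at_right 0)"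
    and h: "filterlim h (at_right 0) F"
    and a: "(a \<longlongrightarrow> s) F" "\<forall>\<^sub>F z in F. a z \<ge> 0" and s: "s \<ge> 0"
    and b: "(b \<longlongrightarrow> t) F" "\<forall>\<^sub>F z in F. b z \<ge> 0" and t: "t \<ge> 0"
  shows "((\<lambda>z. D (h z * a z) (h z * b z) / h z) \<longlongrightarrow> l) F"
proof -
  have h0: "(h \<longlongrightarrow> 0) F" and hpos: "\<forall>\<^sub>F z in F. h z > 0"
    using h unfolding filterlim_at by (auto elim: eventually_mono)
  have "((\<lambda>z. h z * a z) \<longlongrightarrow> 0) F" "((\<lambda>z. h z * b z) \<longlongrightarrow> 0) F"
    using tendsto_mult[OF h0 a(1)] tendsto_mult[OF h0 b(1)] by simp_all
  then have small: "\<forall>\<^sub>F z in F. h z * a z < 1" "\<forall>\<^sub>F z in F. h z * b z < 1"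
    by (auto intro: order_tendstoD)
  have exact_small: "\<forall>\<^sub>F z in F. h z * s \<in> {0..1}" "\<forall>\<^sub>F z in F. h z * t \<in> {0..1}"
    using eventually_compose_filterlim[OF eventually_times_in_unit h] s t by blast+
  have bound: "\<forall>\<^sub>F z in F. norm (D (h z * a z) (h z * b z) / h z - D (h z * s) (h z * t) / h z)
      \<le> norm (\<bar>a z - s\<bar> + \<bar>b z - t\<bar>) * 1"
    using hpos small exact_small a(2) b(2)
  proof eventually_elim
    case (elim z)
    then have "\<bar>D (h z * a z) (h z * b z) - D (h z * s) (h z * t)\<bar>
        \<le> \<bar>h z * a z - h z * s\<bar> + \<bar>h z * b z - h z * t\<bar>"
      using D by (auto simp: unit_square_lipschitz_def)
    also have "\<dots> = h z * (\<bar>a z - s\<bar> + \<bar>b z - t\<bar>)"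
      using elim by (simp add: abs_mult distrib_left flip: right_diff_distrib)
    finally show ?case
      using elim by (simp add: pos_divide_le_eq mult.commute flip: diff_divide_distrib)
  qed
  have "((\<lambda>z. \<bar>a z - s\<bar> + \<bar>b z - t\<bar>) \<longlongrightarrow> 0) F"
    using a(1) b(1) by (auto intro!: tendsto_eq_intros)
  then have diff: "((\<lambda>z. D (h z * a z) (h z * b z) / h z - D (h z * s) (h z * t) / h z) \<longlongrightarrow> 0) F"
    using bound by (rule tendsto_0_le)
  have "((\<lambda>z. D (h z * s) (h z * t) / h z) \<longlongrightarrow> l) F"
    by (rule filterlim_compose[OF lim h])
  from tendsto_add[OF diff this] show ?thesis
    by simp
qed

text \<open>
  The case of the reflected copula with \<open>h \<epsilon> = \<epsilon>\<close>, where the directions are the difference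
  quotients of the curve \<open>(p, q)\<close> that ends in the upper corner.
\<close>

lemma upper_corner_limit_perturb:
  assumes C: "bivariate_copula C"
    and lim: "((\<lambda>\<epsilon>. (C (1 - \<epsilon> * s) (1 - \<epsilon> * t) - 1) / \<epsilon>) \<longlongrightarrow> l) (at_right 0)"
    and p: "((\<lambda>\<epsilon>. (1 - p \<epsilon>) / \<epsilon>) \<longlongrightarrow> s) (at_right 0)" "\<forall>\<^sub>F \<epsilon> in at_right 0. p \<epsilon> \<le> 1"
      and s: "s \<ge> 0"
    and q: "((\<lambda>\<epsilon>. (1 - q \<epsilon>) / \<epsilon>) \<longlongrightarrow> t) (at_right 0)" "\<forall>\<^sub>F \<epsilon> in at_right 0. q \<epsilon> \<le> 1"
      and t: "t \<ge> 0"
  shows "((\<lambda>\<epsilon>. (C (p \<epsilon>) (q \<epsilon>) - 1) / \<epsilon>) \<longlongrightarrow> l) (at_right 0)"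
proof -
  have pos: "\<forall>\<^sub>F \<epsilon> in at_right (0::real). \<epsilon> > 0"
    by (rule eventually_at_right_less)
  have nonneg: "\<forall>\<^sub>F \<epsilon> in at_right 0. (1 - p \<epsilon>) / \<epsilon> \<ge> 0" "\<forall>\<^sub>F \<epsilon> in at_right 0. (1 - q \<epsilon>) / \<epsilon> \<ge> 0"
    using pos p(2) q(2) by (auto elim: eventually_elim2)
  have "((\<lambda>\<epsilon>. (C (1 - \<epsilon> * ((1 - p \<epsilon>) / \<epsilon>)) (1 - \<epsilon> * ((1 - q \<epsilon>) / \<epsilon>)) - 1) / \<epsilon>) \<longlongrightarrow> l)
      (at_right 0)"
    by (rule corner_limit_perturb[where D = "\<lambda>u v. C (1 - u) (1 - v) - 1" and h = "\<lambda>\<epsilon>. \<epsilon>"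
          and s = s and t = t])
      (use copula_reflected_lipschitz[OF C] lim p(1) q(1) nonneg s t in \<open>auto simp: filterlim_ident\<close>)
  then show ?thesis
    by (rule Lim_transform_eventually) (use pos in eventually_elim, simp)
qed

section \<open>Tail dependence functions\<close>

lemma lower_tail_limitI:
  assumes "((\<lambda>\<epsilon>. C (\<epsilon> * x) (\<epsilon> * y) / \<epsilon>) \<longlongrightarrow> l) (at_right 0)"
  shows "lower_tail_exists C x y \<and> Lambda_L C x y = l"
  using assms unfolding lower_tail_exists_def Lambda_L_def
  by (auto intro: tendsto_Lim)

lemma lower_tail_limitD:
  assumes "lower_tail_exists C x y"
  shows "((\<lambda>\<epsilon>. C (\<epsilon> * x) (\<epsilon> * y) / \<epsilon>) \<longlongrightarrow> Lambda_L C x y) (at_right 0)"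
  using assms lower_tail_limitI unfolding lower_tail_exists_def by metis

lemma upper_tail_limitI:
  assumes "((\<lambda>\<epsilon>. (C (1 - \<epsilon> * x) (1 - \<epsilon> * y) - 1) / \<epsilon>) \<longlongrightarrow> l) (at_right 0)"
  shows "upper_tail_exists C x y \<and> Lambda_U C x y = x + y + l"
  using assms unfolding upper_tail_exists_def Lambda_U_def
  by (auto intro: tendsto_Lim)

lemma upper_tail_limitD:
  assumes "upper_tail_exists C x y"
  shows "((\<lambda>\<epsilon>. (C (1 - \<epsilon> * x) (1 - \<epsilon> * y) - 1) / \<epsilon>) \<longlongrightarrow> Lambda_U C x y - x - y) (at_right 0)"
proof -
  obtain l where l: "((\<lambda>\<epsilon>. (C (1 - \<epsilon> * x) (1 - \<epsilon> * y) - 1) / \<epsilon>) \<longlongrightarrow> l) (at_right 0)"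
    using assms unfolding upper_tail_exists_def by blast
  moreover have "l = Lambda_U C x y - x - y"
    using upper_tail_limitI[of C x y l] l by simp
  ultimately show ?thesis
    by simp
qed

lemma Lambda_U_homogeneous:
  assumes C: "bivariate_copula C" and ex: "upper_tail_exists C x y" and c: "c \<ge> 0"
  shows "Lambda_U C (c * x) (c * y) = c * Lambda_U C x y"
proof (cases "c = 0")
  case True
  have "Lambda_U C 0 0 = 0 + 0 + 0"
    by (rule conjunct2[OF upper_tail_limitI]) (use copula_margins[OF C, of 1] in simp)
  with True show ?thesis
    by simp
next
  case False
  with c have c: "c > 0"
    by simp
  have "((\<lambda>\<epsilon>. c * ((C (1 - \<epsilon> * c * x) (1 - \<epsilon> * c * y) - 1) / (\<epsilon> * c)))
      \<longlongrightarrow> c * (Lambda_U C x y - x - y)) (at_right 0)"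
    by (intro tendsto_mult_left
        filterlim_compose[OF upper_tail_limitD[OF ex] filterlim_times_at_right_0[OF c]])
  then have "((\<lambda>\<epsilon>. (C (1 - \<epsilon> * (c * x)) (1 - \<epsilon> * (c * y)) - 1) / \<epsilon>)
      \<longlongrightarrow> c * (Lambda_U C x y - x - y)) (at_right 0)"
    using c by (simp add: mult.assoc)
  then have "Lambda_U C (c * x) (c * y) = c * x + c * y + c * (Lambda_U C x y - x - y)"
    by (rule conjunct2[OF upper_tail_limitI])
  then show ?thesis
    by (simp add: algebra_simps)
qed

section \<open>Regularly varying generators\<close>

text \<open>
  The infimum \<open>L\<close> of \<open>g\<close> over \<open>(0, 1]\<close> cannot be positive: for small \<open>\<epsilon>\<close>, halving the argument
  multiplies \<open>g\<close> by at most some \<open>q < 1\<close>, so that \<open>g \<epsilon> \<ge> L / q\<close>. By monotonicity \<open>L / q\<close> would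
  be a lower bound that exceeds the infimum.
\<close>

lemma regularly_varying_tendsto_0:
  assumes rv: "regularly_varying_at_0 g \<gamma>" and \<gamma>: "\<gamma> > 0" and mono: "mono_on {0..1} g"
  shows "filterlim g (at_right 0) (at_right 0)"
proof -
  have pos: "g u > 0" if "0 < u" "u \<le> 1" for u
    using rv that unfolding regularly_varying_at_0_def by auto
  have mono': "g u \<le> g v" if "0 \<le> u" "u \<le> v" "v \<le> 1" for u v
    using mono_onD[OF mono, of u v] that by auto
  define L where "L = Inf (g ` {0<..1})"
  have bdd: "bdd_below (g ` {0<..1})"
    by (rule bdd_belowI[of _ 0]) (use pos in \<open>auto intro: less_imp_le\<close>)
  have lower: "L \<le> g u" if "0 < u" "u \<le> 1" for u
    unfolding L_def by (rule cInf_lower) (use that bdd in auto)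
  have "L \<le> 0"
  proof (rule ccontr)
    assume "\<not> L \<le> 0"
    then have L: "L > 0"
      by simp
    have "(1/2::real) powr \<gamma> < 1"
      using powr_less_mono2[OF \<gamma>, of "1/2" 1] by simp
    then obtain q where q: "(1/2::real) powr \<gamma> < q" "q < 1"
      using dense by blast
    have q0: "q > 0"
      using q(1) powr_ge_zero[of "1/2::real" \<gamma>] by linarith
    have "((\<lambda>\<epsilon>. g (\<epsilon> * (1/2)) / g \<epsilon>) \<longlongrightarrow> (1/2) powr \<gamma>) (at_right 0)"
      using rv unfolding regularly_varying_at_0_def by (metis half_gt_zero_iff zero_less_one)
    then have "\<forall>\<^sub>F \<epsilon> in at_right 0. g (\<epsilon> * (1/2)) / g \<epsilon> < q"
      using q(1) by (rule order_tendstoD)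
    then obtain \<delta> where \<delta>: "\<delta> > 0" "\<And>\<epsilon>. \<lbrakk>0 < \<epsilon>; \<epsilon> < \<delta>\<rbrakk> \<Longrightarrow> g (\<epsilon> * (1/2)) / g \<epsilon> < q"
      unfolding eventually_at_right_field by auto
    have "L / q \<le> g u" if u: "0 < u" "u \<le> 1" for u
    proof -
      define \<epsilon> where "\<epsilon> = min u (\<delta>/2)"
      have \<epsilon>: "0 < \<epsilon>" "\<epsilon> < \<delta>" "\<epsilon> \<le> u" "\<epsilon> \<le> 1"
        using u \<delta>(1) by (auto simp: \<epsilon>_def)
      have "L \<le> g (\<epsilon> * (1/2))"
        by (rule lower) (use \<epsilon> in auto)
      also have "\<dots> \<le> q * g \<epsilon>"
        using \<delta>(2)[OF \<epsilon>(1,2)] pos[OF \<epsilon>(1,4)] by (simp add: pos_divide_less_eq)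
      also have "\<dots> \<le> q * g u"
        using mono'[of \<epsilon> u] \<epsilon> u q0 by simp
      finally show ?thesis
        using q0 by (simp add: pos_divide_le_eq mult.commute)
    qed
    then have "L / q \<le> L"
      unfolding L_def by (intro cInf_greatest) auto
    moreover have "L < L / q"
      using L q0 q(2) by (simp add: pos_less_divide_eq)
    ultimately show False
      by simp
  qed
  show ?thesis
    unfolding filterlim_at
  proof
    have "\<forall>\<^sub>F \<epsilon> in at_right (0::real). \<epsilon> < 1"
      by (rule eventually_at_right_real[of 0 1, THEN eventually_mono]) auto
    with eventually_at_right_less[of 0]
    have unit: "\<forall>\<^sub>F \<epsilon> in at_right (0::real). 0 < \<epsilon> \<and> \<epsilon> \<le> 1"
      by eventually_elim auto
    then show "\<forall>\<^sub>F \<epsilon> in at_right 0. g \<epsilon> \<in> {0<..} \<and> g \<epsilon> \<noteq> 0"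
      by eventually_elim (use pos in force)
    show "(g \<longlongrightarrow> 0) (at_right 0)"
    proof (rule order_tendstoI)
      fix e :: real assume "e < 0"
      then show "\<forall>\<^sub>F \<epsilon> in at_right 0. e < g \<epsilon>"
        using unit by (auto elim!: eventually_mono dest: pos)
    next
      fix e :: real assume "0 < e"
      with \<open>L \<le> 0\<close> have "Inf (g ` {0<..1}) < e"
        by (simp add: L_def)
      then obtain u where u: "0 < u" "u \<le> 1" "g u < e"
        using bdd by (subst (asm) cInf_less_iff) auto
      have "\<forall>\<^sub>F \<epsilon> in at_right 0. 0 < \<epsilon> \<and> \<epsilon> < u"
        using eventually_at_right_real[OF u(1)] by simp
      then show "\<forall>\<^sub>F \<epsilon> in at_right 0. g \<epsilon> < e"
      proof eventually_elim
        case (elim \<epsilon>)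
        then show ?case
          using mono'[of \<epsilon> u] u by simp
      qed
    qed
  qed
qed

text \<open>
  At \<open>x = 0\<close> both sides are \<open>0\<close>; this is the boundary value \<open>0 powr \<gamma> = 0\<close>.
\<close>

lemma regularly_varying_ratio_tendsto:
  assumes rv: "regularly_varying_at_0 g \<gamma>" and g0: "g 0 = 0" and x: "x \<ge> 0"
  shows "((\<lambda>\<epsilon>. g (\<epsilon> * x) / g \<epsilon>) \<longlongrightarrow> x powr \<gamma>) (at_right 0)"
proof (cases "x = 0")
  case True
  with g0 show ?thesis
    by simp
next
  case False
  with rv x show ?thesis
    unfolding regularly_varying_at_0_def by simp
qed

lemma copula_regularly_varying_limit:
  assumes C: "bivariate_copula C" and rv: "regularly_varying_at_0 g \<gamma>" and \<gamma>: "\<gamma> > 0"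
    and mono: "mono_on {0..1} g" and g0: "g 0 = 0" and x: "x \<ge> 0" and y: "y \<ge> 0"
    and ex: "lower_tail_exists C (x powr \<gamma>) (y powr \<gamma>)"
  shows "((\<lambda>\<epsilon>. C (g (\<epsilon> * x)) (g (\<epsilon> * y)) / g \<epsilon>) \<longlongrightarrow> Lambda_L C (x powr \<gamma>) (y powr \<gamma>))
    (at_right 0)"
proof -
  have g: "filterlim g (at_right 0) (at_right 0)"
    by (rule regularly_varying_tendsto_0[OF rv \<gamma> mono])
  then have gpos: "\<forall>\<^sub>F \<epsilon> in at_right 0. g \<epsilon> > 0"
    unfolding filterlim_at by (auto elim: eventually_mono)
  have nonneg: "\<forall>\<^sub>F \<epsilon> in at_right 0. g (\<epsilon> * z) / g \<epsilon> \<ge> 0" if "z \<ge> 0" for z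
    using gpos eventually_times_in_unit[OF that]
  proof eventually_elim
    case (elim \<epsilon>)
    then have "g (\<epsilon> * z) \<in> {0..1}"
      using rv unfolding regularly_varying_at_0_def by blast
    with elim show ?case
      by simp
  qed
  have "((\<lambda>\<epsilon>. C (g \<epsilon> * (g (\<epsilon> * x) / g \<epsilon>)) (g \<epsilon> * (g (\<epsilon> * y) / g \<epsilon>)) / g \<epsilon>)
      \<longlongrightarrow> Lambda_L C (x powr \<gamma>) (y powr \<gamma>)) (at_right 0)"
    by (rule corner_limit_perturb[OF copula_lipschitz[OF C] lower_tail_limitD[OF ex] g])
      (use regularly_varying_ratio_tendsto[OF rv g0] nonneg x y in auto)
  then show ?thesis
    by (rule Lim_transform_eventually) (use gpos in eventually_elim, simp)
qed

section \<open>Factorizations of the identity into increasing generators\<close>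

text \<open>
  The family \<open>h\<close> stands for the generators \<open>g j\<close> of a Liebscher copula for one coordinate \<open>j\<close>.
\<close>

definition identity_factorization :: "nat \<Rightarrow> (nat \<Rightarrow> real \<Rightarrow> real) \<Rightarrow> bool" where
  "identity_factorization K h \<longleftrightarrow>
     (\<forall>k\<in>{1..K}. h k ` {0..1} \<subseteq> {0..1} \<and> mono_on {0..1} (h k) \<and> h k 0 = 0 \<and> h k 1 = 1) \<and>
     (\<forall>u\<in>{0..1}. (\<Prod>k=1..K. h k u) = u)"

lemma identity_factorizationD:
  assumes "identity_factorization K h"
  shows "\<lbrakk>k \<in> {1..K}; u \<in> {0..1}\<rbrakk> \<Longrightarrow> h k u \<in> {0..1}"
    and "k \<in> {1..K} \<Longrightarrow> mono_on {0..1} (h k)"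
    and "k \<in> {1..K} \<Longrightarrow> h k 0 = 0"
    and "k \<in> {1..K} \<Longrightarrow> h k 1 = 1"
    and "u \<in> {0..1} \<Longrightarrow> (\<Prod>k=1..K. h k u) = u"
  using assms unfolding identity_factorization_def by blast+

lemma identity_factorization_pos:
  assumes h: "identity_factorization K h" and k: "k \<in> {1..K}" and u: "0 < u" "u \<le> 1"
  shows "h k u > 0"
proof -
  have "(\<Prod>k=1..K. h k u) \<noteq> 0"
    using identity_factorizationD(5)[OF h] u by auto
  then have "h k u \<noteq> 0"
    using k by auto
  moreover have "h k u \<ge> 0"
    using identity_factorizationD(1)[OF h k] u by auto
  ultimately show ?thesis
    by simp
qed

lemma sum_indices_eq_1:
  assumes h: "identity_factorization K h"
    and rv: "\<And>k. k \<in> {1..K} \<Longrightarrow> regularly_varying_at_0 (h k) (\<gamma> k)"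
  shows "(\<Sum>k=1..K. \<gamma> k) = 1"
proof -
  have "((\<lambda>\<epsilon>. \<Prod>k=1..K. h k (\<epsilon> * 2) / h k \<epsilon>) \<longlongrightarrow> (\<Prod>k=1..K. 2 powr \<gamma> k)) (at_right 0)"
    by (intro tendsto_prod) (use rv in \<open>auto simp: regularly_varying_at_0_def\<close>)
  moreover have "((\<lambda>\<epsilon>. \<Prod>k=1..K. h k (\<epsilon> * 2) / h k \<epsilon>) \<longlongrightarrow> 2) (at_right 0)"
  proof (rule Lim_transform_eventually[OF tendsto_const])
    show "\<forall>\<^sub>F \<epsilon> in at_right 0. 2 = (\<Prod>k=1..K. h k (\<epsilon> * 2) / h k \<epsilon>)"
      using eventually_at_right_less[of 0] eventually_times_in_unit[of 2, OF zero_le_numeral]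
    proof eventually_elim
      case (elim \<epsilon>)
      then have "(\<Prod>k=1..K. h k (\<epsilon> * 2)) = \<epsilon> * 2" "(\<Prod>k=1..K. h k \<epsilon>) = \<epsilon>"
        by (intro identity_factorizationD(5)[OF h]; simp)+
      with elim show ?case
        by (simp add: prod_dividef)
    qed
  qed
  ultimately have "(\<Prod>k=1..K. (2::real) powr \<gamma> k) = 2"
    by (rule tendsto_unique[rotated]) simp
  then have "(2::real) powr (\<Sum>k=1..K. \<gamma> k) = 2 powr 1"
    by (simp add: powr_sum)
  then show ?thesis
    by (subst (asm) powr_inj) auto
qed

lemma derivative_at_1_nonneg:
  assumes h: "identity_factorization K h" and k: "k \<in> {1..K}"
    and d: "(h k has_real_derivative d) (at_left 1)"
  shows "d \<ge> 0"
proof (rule tendsto_lowerbound)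
  show "((\<lambda>u. (h k u - h k 1) / (u - 1)) \<longlongrightarrow> d) (at_left 1)"
    using d unfolding has_field_derivative_iff .
  have "\<forall>\<^sub>F u in at_left (1::real). 0 < u \<and> u < 1"
    using eventually_at_left_real[of 0 1] by simp
  then show "\<forall>\<^sub>F u in at_left 1. 0 \<le> (h k u - h k 1) / (u - 1)"
  proof eventually_elim
    case (elim u)
    then have "h k u \<le> h k 1"
      using identity_factorizationD(1)[OF h k, of u] identity_factorizationD(4)[OF h k] by auto
    with elim show ?case
      by (simp add: divide_nonpos_nonpos)
  qed
qed simp

text \<open>
  Generators at \<open>1\<close> and copula factors at the upper corner all have the value \<open>1\<close>, so that the
  cofactors in the product rule disappear.
\<close>

lemma has_real_derivative_prod_at_one:
  fixes f :: "'i \<Rightarrow> real \<Rightarrow> real"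
  assumes f: "\<And>i. i \<in> I \<Longrightarrow> (f i has_real_derivative f' i) (at z within S)"
    and one: "\<And>i. i \<in> I \<Longrightarrow> f i z = 1"
  shows "((\<lambda>u. \<Prod>i\<in>I. f i u) has_real_derivative (\<Sum>i\<in>I. f' i)) (at z within S)"
proof -
  have "((\<lambda>u. \<Prod>i\<in>I. f i u) has_derivative
      (\<lambda>y. \<Sum>i\<in>I. (f' i * y) * (\<Prod>j\<in>I - {i}. f j z))) (at z within S)"
    by (rule has_derivative_prod) (use f in \<open>simp add: has_field_derivative_def\<close>)
  moreover have "(\<lambda>y. \<Sum>i\<in>I. (f' i * y) * (\<Prod>j\<in>I - {i}. f j z)) = (*) (\<Sum>i\<in>I. f' i)"
    by (rule ext) (simp add: one sum_distrib_right)
  ultimately show ?thesis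
    by (simp add: has_field_derivative_def)
qed

text \<open>The two sides are derivatives at \<open>1\<close> of the same function, the identity.\<close>

lemma sum_derivatives_at_1_eq_1:
  assumes h: "identity_factorization K h"
    and d: "\<And>k. k \<in> {1..K} \<Longrightarrow> (h k has_real_derivative d k) (at_left 1)"
  shows "(\<Sum>k=1..K. d k) = 1"
proof -
  have "((\<lambda>u. \<Prod>k=1..K. h k u) has_real_derivative (\<Sum>k=1..K. d k)) (at_left 1)"
    by (rule has_real_derivative_prod_at_one) (use d identity_factorizationD(4)[OF h] in auto)
  then have "((\<lambda>u. ((\<Prod>k=1..K. h k u) - (\<Prod>k=1..K. h k 1)) / (u - 1)) \<longlongrightarrow> (\<Sum>k=1..K. d k))
      (at_left 1)"
    unfolding has_field_derivative_iff .
  moreover have "((\<lambda>u. ((\<Prod>k=1..K. h k u) - (\<Prod>k=1..K. h k 1)) / (u - 1)) \<longlongrightarrow> 1) (at_left 1)"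
  proof (rule Lim_transform_eventually[OF tendsto_const])
    have "\<forall>\<^sub>F u in at_left (1::real). 0 < u \<and> u < 1"
      using eventually_at_left_real[of 0 1] by simp
    then show "\<forall>\<^sub>F u in at_left 1. 1 = ((\<Prod>k=1..K. h k u) - (\<Prod>k=1..K. h k 1)) / (u - 1)"
    proof eventually_elim
      case (elim u)
      then have "(\<Prod>k=1..K. h k u) = u" "(\<Prod>k=1..K. h k 1) = 1"
        by (intro identity_factorizationD(5)[OF h]; simp)+
      with elim show ?case
        by simp
    qed
  qed
  ultimately show ?thesis
    by (rule tendsto_unique[rotated]) simp
qed

lemma left_derivative_along_ray:
  fixes f :: "real \<Rightarrow> real"
  assumes d: "(f has_real_derivative d) (at_left 1)" and f1: "f 1 = 1" and x: "x \<ge> 0"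
  shows "((\<lambda>\<epsilon>. (1 - f (1 - \<epsilon> * x)) / \<epsilon>) \<longlongrightarrow> d * x) (at_right 0)"
proof (cases "x = 0")
  case True
  with f1 show ?thesis
    by simp
next
  case False
  with x have x: "x > 0"
    by simp
  have ray: "filterlim (\<lambda>\<epsilon>. 1 - \<epsilon> * x) (at_left 1) (at_right 0)"
    unfolding filterlim_at
  proof
    show "\<forall>\<^sub>F \<epsilon> in at_right 0. 1 - \<epsilon> * x \<in> {..<1} \<and> 1 - \<epsilon> * x \<noteq> 1"
      using eventually_at_right_less[of 0] by eventually_elim (use x in auto)
    show "((\<lambda>\<epsilon>. 1 - \<epsilon> * x) \<longlongrightarrow> 1) (at_right 0)"
      by (auto intro!: tendsto_eq_intros)
  qed
  have "((\<lambda>u. (f u - f 1) / (u - 1)) \<longlongrightarrow> d) (at_left 1)"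
    using d unfolding has_field_derivative_iff .
  from tendsto_mult_right[OF filterlim_compose[OF this ray], of x]
  show ?thesis
    by (rule Lim_transform_eventually)
      (use x f1 in \<open>auto simp: divide_simps algebra_simps intro!: always_eventually\<close>)
qed

section \<open>The Liebscher copula\<close>

lemma liebscher_lower_tail_symmetric:
  assumes h: "identity_factorization K h"
    and C: "\<And>k. k \<in> {1..K} \<Longrightarrow> bivariate_copula (C k)"
    and eq: "\<And>k u. \<lbrakk>k \<in> {1..K}; u \<in> {0..1}\<rbrakk> \<Longrightarrow> g 1 k u = h k u \<and> g 2 k u = h k u"
    and rv: "\<And>k. k \<in> {1..K} \<Longrightarrow> \<gamma> k > 0 \<and> regularly_varying_at_0 (h k) (\<gamma> k)"
    and ex: "\<And>k. k \<in> {1..K} \<Longrightarrow> lower_tail_exists (C k) (x powr \<gamma> k) (y powr \<gamma> k)"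
    and x: "x \<ge> 0" and y: "y \<ge> 0"
  shows "((\<lambda>\<epsilon>. liebscher K C g (\<epsilon> * x) (\<epsilon> * y) / \<epsilon>)
    \<longlongrightarrow> (\<Prod>k=1..K. Lambda_L (C k) (x powr \<gamma> k) (y powr \<gamma> k))) (at_right 0)"
proof -
  have "((\<lambda>\<epsilon>. \<Prod>k=1..K. C k (h k (\<epsilon> * x)) (h k (\<epsilon> * y)) / h k \<epsilon>)
      \<longlongrightarrow> (\<Prod>k=1..K. Lambda_L (C k) (x powr \<gamma> k) (y powr \<gamma> k))) (at_right 0)"
    by (intro tendsto_prod copula_regularly_varying_limit)
      (use C rv ex x y identity_factorizationD[OF h] in auto)
  then show ?thesis
  proof (rule Lim_transform_eventually)
    show "\<forall>\<^sub>F \<epsilon> in at_right 0. (\<Prod>k=1..K. C k (h k (\<epsilon> * x)) (h k (\<epsilon> * y)) / h k \<epsilon>)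
        = liebscher K C g (\<epsilon> * x) (\<epsilon> * y) / \<epsilon>"
      using eventually_times_in_unit[OF x] eventually_times_in_unit[OF y]
        eventually_times_in_unit[of 1, simplified]
    proof eventually_elim
      case (elim \<epsilon>)
      have "liebscher K C g (\<epsilon> * x) (\<epsilon> * y) = (\<Prod>k=1..K. C k (h k (\<epsilon> * x)) (h k (\<epsilon> * y)))"
        unfolding liebscher_def by (intro prod.cong refl) (use eq elim in auto)
      with elim show ?case
        using identity_factorizationD(5)[OF h, of \<epsilon>] by (simp add: prod_dividef)
    qed
  qed
qed

text \<open>
  Both \<open>\<epsilon> x\<close> and \<open>\<epsilon> y\<close> are first enlarged to a common value \<open>\<epsilon> m\<close>, so that the product of
  the bounds differs from the factorization of \<open>\<epsilon> m\<close> only in the factor with index \<open>k\<^sub>0\<close>.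
\<close>

lemma liebscher_lower_tail_asymmetric:
  assumes g1: "identity_factorization K (g 1)" and g2: "identity_factorization K (g 2)"
    and C: "\<And>k. k \<in> {1..K} \<Longrightarrow> bivariate_copula (C k)"
    and k0: "k0 \<in> {1..K}" and lim: "((\<lambda>\<epsilon>. g 1 k0 \<epsilon> / g 2 k0 \<epsilon>) \<longlongrightarrow> 0) (at_right 0)"
    and x: "x \<ge> 0" and y: "y \<ge> 0"
  shows "((\<lambda>\<epsilon>. liebscher K C g (\<epsilon> * x) (\<epsilon> * y) / \<epsilon>) \<longlongrightarrow> 0) (at_right 0)"
proof -
  \<comment> \<open>The summand \<open>1\<close> keeps \<open>m\<close> positive when \<open>x = y = 0\<close>.\<close>
  define m where "m = x + y + 1"
  have m: "m > 0" "x \<le> m" "y \<le> m"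
    using x y by (auto simp: m_def)
  have upper: "((\<lambda>\<epsilon>. m * (g 1 k0 (\<epsilon> * m) / g 2 k0 (\<epsilon> * m))) \<longlongrightarrow> 0) (at_right 0)"
    using tendsto_mult_left[OF filterlim_compose[OF lim filterlim_times_at_right_0[OF m(1)]], of m]
    by simp
  have bounds: "\<forall>\<^sub>F \<epsilon> in at_right 0. 0 \<le> liebscher K C g (\<epsilon> * x) (\<epsilon> * y) / \<epsilon> \<and>
      liebscher K C g (\<epsilon> * x) (\<epsilon> * y) / \<epsilon> \<le> m * (g 1 k0 (\<epsilon> * m) / g 2 k0 (\<epsilon> * m))"
    using eventually_at_right_less[of 0] eventually_times_in_unit[OF less_imp_le[OF m(1)]]
  proof eventually_elim
    case (elim \<epsilon>)
    have le: "\<epsilon> * x \<le> \<epsilon> * m" "\<epsilon> * y \<le> \<epsilon> * m" and pos: "0 < \<epsilon> * m"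
      using elim m by auto
    have unit: "\<epsilon> * x \<in> {0..1}" "\<epsilon> * y \<in> {0..1}"
      using elim(1) elim(2) x y order_trans[OF le(1)] order_trans[OF le(2)] by auto
    have factor: "0 \<le> C k (g 1 k (\<epsilon> * x)) (g 2 k (\<epsilon> * y))"
      "C k (g 1 k (\<epsilon> * x)) (g 2 k (\<epsilon> * y)) \<le> g 1 k (\<epsilon> * m)"
      "C k (g 1 k (\<epsilon> * x)) (g 2 k (\<epsilon> * y)) \<le> g 2 k (\<epsilon> * m)" if k: "k \<in> {1..K}" for k
    proof -
      have in1: "g 1 k (\<epsilon> * x) \<in> {0..1}" and in2: "g 2 k (\<epsilon> * y) \<in> {0..1}"
        using identity_factorizationD(1)[OF g1 k unit(1)] identity_factorizationD(1)[OF g2 k unit(2)] .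
      show "0 \<le> C k (g 1 k (\<epsilon> * x)) (g 2 k (\<epsilon> * y))"
        by (rule copula_nonneg[OF C[OF k] in1 in2])
      show "C k (g 1 k (\<epsilon> * x)) (g 2 k (\<epsilon> * y)) \<le> g 1 k (\<epsilon> * m)"
        using copula_le_fst[OF C[OF k] in1 in2]
          mono_onD[OF identity_factorizationD(2)[OF g1 k] unit(1) elim(2) le(1)]
        by (rule order_trans)
      show "C k (g 1 k (\<epsilon> * x)) (g 2 k (\<epsilon> * y)) \<le> g 2 k (\<epsilon> * m)"
        using copula_le_snd[OF C[OF k] in1 in2]
          mono_onD[OF identity_factorizationD(2)[OF g2 k] unit(2) elim(2) le(2)]
        by (rule order_trans)
    qed
    have g2pos: "g 2 k0 (\<epsilon> * m) > 0"
      using identity_factorization_pos[OF g2 k0 pos] elim by auto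
    have "liebscher K C g (\<epsilon> * x) (\<epsilon> * y)
        \<le> (\<Prod>k=1..K. if k = k0 then g 1 k (\<epsilon> * m) else g 2 k (\<epsilon> * m))"
      unfolding liebscher_def by (rule prod_mono) (use factor in auto)
    also have "\<dots> = g 1 k0 (\<epsilon> * m) * (\<Prod>k\<in>{1..K} - {k0}. g 2 k (\<epsilon> * m))"
      using k0 by (subst prod.remove[of _ k0]) (auto intro!: prod.cong)
    also have "(\<Prod>k\<in>{1..K} - {k0}. g 2 k (\<epsilon> * m)) = \<epsilon> * m / g 2 k0 (\<epsilon> * m)"
      using prod.remove[of "{1..K}" k0 "\<lambda>k. g 2 k (\<epsilon> * m)"] k0 g2pos
        identity_factorizationD(5)[OF g2 elim(2)] by (simp add: field_simps)
    finally have "liebscher K C g (\<epsilon> * x) (\<epsilon> * y)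
        \<le> \<epsilon> * (m * (g 1 k0 (\<epsilon> * m) / g 2 k0 (\<epsilon> * m)))"
      by (simp add: mult_ac)
    moreover have "0 \<le> liebscher K C g (\<epsilon> * x) (\<epsilon> * y)"
      unfolding liebscher_def by (rule prod_nonneg) (use factor in auto)
    ultimately show ?case
      using elim(1) by (simp add: pos_divide_le_eq mult.commute)
  qed
  show ?thesis
    by (rule tendsto_sandwich[OF _ _ tendsto_const upper])
      (use bounds in \<open>auto elim: eventually_mono\<close>)
qed

lemma liebscher_upper_tail_limit:
  fixes d :: "nat \<Rightarrow> nat \<Rightarrow> real"
  assumes g1: "identity_factorization K (g 1)" and g2: "identity_factorization K (g 2)"
    and C: "\<And>k. k \<in> {1..K} \<Longrightarrow> bivariate_copula (C k)"
    and d1: "\<And>k. k \<in> {1..K} \<Longrightarrow> (g 1 k has_real_derivative d 1 k) (at_left 1)"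
    and d2: "\<And>k. k \<in> {1..K} \<Longrightarrow> (g 2 k has_real_derivative d 2 k) (at_left 1)"
    and ex: "\<And>k. k \<in> {1..K} \<Longrightarrow> upper_tail_exists (C k) (d 1 k * x) (d 2 k * y)"
    and x: "x \<ge> 0" and y: "y \<ge> 0"
  shows "((\<lambda>\<epsilon>. (liebscher K C g (1 - \<epsilon> * x) (1 - \<epsilon> * y) - 1) / \<epsilon>)
    \<longlongrightarrow> (\<Sum>k=1..K. Lambda_U (C k) (d 1 k * x) (d 2 k * y)) - x - y) (at_right 0)"
proof -
  define A where "A k \<epsilon> = C k (g 1 k (1 - \<epsilon> * x)) (g 2 k (1 - \<epsilon> * y))" for k \<epsilon>
  define l where "l k = Lambda_U (C k) (d 1 k * x) (d 2 k * y) - d 1 k * x - d 2 k * y" for k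
  have A0: "A k 0 = 1" if "k \<in> {1..K}" for k
    unfolding A_def mult_zero_left diff_zero identity_factorizationD(4)[OF g1 that]
      identity_factorizationD(4)[OF g2 that] by (rule copula_margins(3)[OF C[OF that]]) simp
  have gen_le_1: "\<forall>\<^sub>F \<epsilon> in at_right 0. h k (1 - \<epsilon> * z) \<le> 1"
    if "identity_factorization K h" "k \<in> {1..K}" "z \<ge> 0" for h k and z :: real
    using eventually_times_in_unit[OF that(3)]
    by eventually_elim (use identity_factorizationD(1)[OF that(1,2)] in auto)
  have "(A k has_real_derivative l k) (at_right 0)" if k: "k \<in> {1..K}" for k
  proof -
    have "((\<lambda>\<epsilon>. (A k \<epsilon> - 1) / \<epsilon>) \<longlongrightarrow> l k) (at_right 0)"
      unfolding A_def l_def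
    proof (rule upper_corner_limit_perturb[OF C[OF k] upper_tail_limitD[OF ex[OF k]]])
      show "((\<lambda>\<epsilon>. (1 - g 1 k (1 - \<epsilon> * x)) / \<epsilon>) \<longlongrightarrow> d 1 k * x) (at_right 0)"
        by (rule left_derivative_along_ray[OF d1[OF k] identity_factorizationD(4)[OF g1 k] x])
      show "((\<lambda>\<epsilon>. (1 - g 2 k (1 - \<epsilon> * y)) / \<epsilon>) \<longlongrightarrow> d 2 k * y) (at_right 0)"
        by (rule left_derivative_along_ray[OF d2[OF k] identity_factorizationD(4)[OF g2 k] y])
      show "d 1 k * x \<ge> 0" "d 2 k * y \<ge> 0"
        using derivative_at_1_nonneg[OF g1 k d1[OF k]] derivative_at_1_nonneg[OF g2 k d2[OF k]] x y
        by simp_all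
      show "\<forall>\<^sub>F \<epsilon> in at_right 0. g 1 k (1 - \<epsilon> * x) \<le> 1"
        by (rule gen_le_1[OF g1 k x])
      show "\<forall>\<^sub>F \<epsilon> in at_right 0. g 2 k (1 - \<epsilon> * y) \<le> 1"
        by (rule gen_le_1[OF g2 k y])
    qed
    then show ?thesis
      by (simp add: has_field_derivative_iff A0[OF k])
  qed
  then have "((\<lambda>\<epsilon>. \<Prod>k=1..K. A k \<epsilon>) has_real_derivative (\<Sum>k=1..K. l k)) (at_right 0)"
    using A0 by (rule has_real_derivative_prod_at_one)
  then have "((\<lambda>\<epsilon>. ((\<Prod>k=1..K. A k \<epsilon>) - 1) / \<epsilon>) \<longlongrightarrow> (\<Sum>k=1..K. l k)) (at_right 0)"
    by (simp add: has_field_derivative_iff A0)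
  moreover have "(\<Sum>k=1..K. l k)
      = (\<Sum>k=1..K. Lambda_U (C k) (d 1 k * x) (d 2 k * y)) - x - y"
    using sum_derivatives_at_1_eq_1[OF g1 d1] sum_derivatives_at_1_eq_1[OF g2 d2]
    by (simp add: l_def sum_subtractf flip: sum_distrib_right)
  ultimately show ?thesis
    by (simp add: liebscher_def A_def)
qed

theorem proposition1:
  fixes K :: nat
    and C :: "nat \<Rightarrow> real \<Rightarrow> real \<Rightarrow> real"
    and g :: "nat \<Rightarrow> nat \<Rightarrow> real \<Rightarrow> real"
    and \<gamma> :: "nat \<Rightarrow> real"
    and d :: "nat \<Rightarrow> nat \<Rightarrow> real"
    and x y :: real
  assumes "K \<ge> 1"
    and "\<forall>k\<in>{1..K}. bivariate_copula (C k)"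
    and "\<forall>j\<in>{1,2}. \<forall>k\<in>{1..K}. g j k ` {0..1} \<subseteq> {0..1} \<and> mono_on {0..1} (g j k) \<and>
           g j k 0 = 0 \<and> g j k 1 = 1"
    and "\<forall>j\<in>{1,2}. \<forall>u\<in>{0..1}. (\<Prod>k=1..K. g j k u) = u"
    and "x \<ge> 0" and "y \<ge> 0"
  shows
    "((\<forall>k\<in>{1..K}. (\<forall>u\<in>{0..1}. g 1 k u = g 2 k u) \<and>
         \<gamma> k > 0 \<and> regularly_varying_at_0 (g 1 k) (\<gamma> k)) \<longrightarrow>
       ((\<forall>k\<in>{1..K}. \<forall>s\<ge>0. \<forall>t\<ge>0. lower_tail_exists (C k) s t) \<longrightarrow>
          lower_tail_exists (liebscher K C g) x y \<and>
          Lambda_L (liebscher K C g) x y =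
            (\<Prod>k=1..K. Lambda_L (C k) (x powr \<gamma> k) (y powr \<gamma> k))) \<and>
       (\<Sum>k=1..K. \<gamma> k) = 1) \<and>
     ((\<exists>k0\<in>{1..K}. ((\<lambda>\<epsilon>. g 1 k0 \<epsilon> / g 2 k0 \<epsilon>) \<longlongrightarrow> 0) (at_right 0)) \<longrightarrow>
       lower_tail_exists (liebscher K C g) x y \<and> Lambda_L (liebscher K C g) x y = 0) \<and>
     ((\<forall>j\<in>{1,2}. \<forall>k\<in>{1..K}. (g j k has_real_derivative d j k) (at_left 1)) \<longrightarrow>
       ((\<forall>k\<in>{1..K}. \<forall>s\<ge>0. \<forall>t\<ge>0. upper_tail_exists (C k) s t) \<longrightarrow>
          upper_tail_exists (liebscher K C g) x y \<and>
          Lambda_U (liebscher K C g) x y =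
            (\<Sum>k=1..K. Lambda_U (C k) (d 1 k * x) (d 2 k * y))) \<and>
       (\<forall>j\<in>{1,2}. (\<Sum>k=1..K. d j k) = 1)) \<and>
     ((\<forall>j\<in>{1,2}. \<forall>k\<in>{1..K}. (g j k has_real_derivative d j k) (at_left 1)) \<and>
     (\<forall>k\<in>{1..K}. d 1 k = d 2 k) \<longrightarrow>
       ((\<forall>k\<in>{1..K}. \<forall>s\<ge>0. \<forall>t\<ge>0. upper_tail_exists (C k) s t) \<longrightarrow>
          upper_tail_exists (liebscher K C g) x y \<and>
          Lambda_U (liebscher K C g) x y = (\<Sum>k=1..K. d 1 k * Lambda_U (C k) x y)) \<and>
       (\<Sum>k=1..K. d 1 k) = 1)"
proof -
  have gen: "identity_factorization K (g 1)" "identity_factorization K (g 2)"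
    using assms(3,4) by (auto simp: identity_factorization_def)
  have C: "bivariate_copula (C k)" if "k \<in> {1..K}" for k
    using assms(2) that by blast
  note x = assms(5) and y = assms(6)

  let ?deriv = "\<forall>j\<in>{1,2}. \<forall>k\<in>{1..K}. (g j k has_real_derivative d j k) (at_left 1)"
  let ?upper = "\<forall>k\<in>{1..K}. \<forall>s\<ge>0. \<forall>t\<ge>0. upper_tail_exists (C k) s t"

  have lower_symmetric: "((\<forall>k\<in>{1..K}. \<forall>s\<ge>0. \<forall>t\<ge>0. lower_tail_exists (C k) s t) \<longrightarrow>
          lower_tail_exists (liebscher K C g) x y \<and>
          Lambda_L (liebscher K C g) x y =
            (\<Prod>k=1..K. Lambda_L (C k) (x powr \<gamma> k) (y powr \<gamma> k))) \<and>
       (\<Sum>k=1..K. \<gamma> k) = 1"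
    if hyp: "\<forall>k\<in>{1..K}. (\<forall>u\<in>{0..1}. g 1 k u = g 2 k u) \<and>
         \<gamma> k > 0 \<and> regularly_varying_at_0 (g 1 k) (\<gamma> k)"
  proof (intro conjI impI)
    show "(\<Sum>k=1..K. \<gamma> k) = 1"
      by (rule sum_indices_eq_1[OF gen(1)]) (use hyp in blast)
  next
    assume ex: "\<forall>k\<in>{1..K}. \<forall>s\<ge>0. \<forall>t\<ge>0. lower_tail_exists (C k) s t"
    have "((\<lambda>\<epsilon>. liebscher K C g (\<epsilon> * x) (\<epsilon> * y) / \<epsilon>)
        \<longlongrightarrow> (\<Prod>k=1..K. Lambda_L (C k) (x powr \<gamma> k) (y powr \<gamma> k))) (at_right 0)"
      by (rule liebscher_lower_tail_symmetric[OF gen(1) C]) (use hyp ex x y in auto)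
    then have "lower_tail_exists (liebscher K C g) x y \<and> Lambda_L (liebscher K C g) x y
        = (\<Prod>k=1..K. Lambda_L (C k) (x powr \<gamma> k) (y powr \<gamma> k))"
      by (rule lower_tail_limitI)
    then show "lower_tail_exists (liebscher K C g) x y"
      "Lambda_L (liebscher K C g) x y = (\<Prod>k=1..K. Lambda_L (C k) (x powr \<gamma> k) (y powr \<gamma> k))"
      by blast+
  qed

  have lower_asymmetric:
    "lower_tail_exists (liebscher K C g) x y \<and> Lambda_L (liebscher K C g) x y = 0"
    if "\<exists>k0\<in>{1..K}. ((\<lambda>\<epsilon>. g 1 k0 \<epsilon> / g 2 k0 \<epsilon>) \<longlongrightarrow> 0) (at_right 0)"
  proof -
    from that obtain k0 where k0: "k0 \<in> {1..K}" "((\<lambda>\<epsilon>. g 1 k0 \<epsilon> / g 2 k0 \<epsilon>) \<longlongrightarrow> 0) (at_right 0)"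
      by blast
    show ?thesis
      by (rule lower_tail_limitI) (rule liebscher_lower_tail_asymmetric[OF gen C k0 x y])
  qed

  have sum_deriv: "(\<Sum>k=1..K. d 1 k) = 1" "(\<Sum>k=1..K. d 2 k) = 1" if ?deriv
    using that sum_derivatives_at_1_eq_1[OF gen(1), of "d 1"]
      sum_derivatives_at_1_eq_1[OF gen(2), of "d 2"] by simp_all
  have deriv_nonneg: "d 1 k \<ge> 0" "d 2 k \<ge> 0" if ?deriv "k \<in> {1..K}" for k
    using that derivative_at_1_nonneg[OF gen(1)] derivative_at_1_nonneg[OF gen(2)] by simp_all

  have upper_tail: "upper_tail_exists (liebscher K C g) x y"
    "Lambda_U (liebscher K C g) x y = (\<Sum>k=1..K. Lambda_U (C k) (d 1 k * x) (d 2 k * y))"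
    if deriv: ?deriv and ex: ?upper
  proof -
    have "((\<lambda>\<epsilon>. (liebscher K C g (1 - \<epsilon> * x) (1 - \<epsilon> * y) - 1) / \<epsilon>)
        \<longlongrightarrow> (\<Sum>k=1..K. Lambda_U (C k) (d 1 k * x) (d 2 k * y)) - x - y) (at_right 0)"
      by (rule liebscher_upper_tail_limit[OF gen C])
        (use deriv ex x y deriv_nonneg[OF deriv] in auto)
    then have "upper_tail_exists (liebscher K C g) x y \<and> Lambda_U (liebscher K C g) x y
        = x + y + ((\<Sum>k=1..K. Lambda_U (C k) (d 1 k * x) (d 2 k * y)) - x - y)"
      by (rule upper_tail_limitI)
    then show "upper_tail_exists (liebscher K C g) x y"
      "Lambda_U (liebscher K C g) x y = (\<Sum>k=1..K. Lambda_U (C k) (d 1 k * x) (d 2 k * y))"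
      by simp_all
  qed

  have upper_tail_equal:
    "Lambda_U (liebscher K C g) x y = (\<Sum>k=1..K. d 1 k * Lambda_U (C k) x y)"
    if deriv: ?deriv and eq: "\<forall>k\<in>{1..K}. d 1 k = d 2 k" and ex: ?upper
    unfolding upper_tail(2)[OF deriv ex]
  proof (intro sum.cong refl)
    fix k assume k: "k \<in> {1..K}"
    then have "Lambda_U (C k) (d 1 k * x) (d 1 k * y) = d 1 k * Lambda_U (C k) x y"
      using Lambda_U_homogeneous[OF C[OF k]] ex x y deriv_nonneg[OF deriv k] by blast
    with eq k show "Lambda_U (C k) (d 1 k * x) (d 2 k * y) = d 1 k * Lambda_U (C k) x y"
      by simp
  qed

  have upper_general: "?deriv \<longrightarrow>
       (?upper \<longrightarrow>
          upper_tail_exists (liebscher K C g) x y \<and>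
          Lambda_U (liebscher K C g) x y =
            (\<Sum>k=1..K. Lambda_U (C k) (d 1 k * x) (d 2 k * y))) \<and>
       (\<forall>j\<in>{1,2}. (\<Sum>k=1..K. d j k) = 1)"
  proof (intro impI conjI)
    assume ?deriv
    then show "\<forall>j\<in>{1,2}. (\<Sum>k=1..K. d j k) = 1"
      using sum_deriv by auto
  qed (fact upper_tail)+

  have upper_particular: "?deriv \<and> (\<forall>k\<in>{1..K}. d 1 k = d 2 k) \<longrightarrow>
       (?upper \<longrightarrow>
          upper_tail_exists (liebscher K C g) x y \<and>
          Lambda_U (liebscher K C g) x y = (\<Sum>k=1..K. d 1 k * Lambda_U (C k) x y)) \<and>
       (\<Sum>k=1..K. d 1 k) = 1"
    by (intro impI conjI; elim conjE) (rule upper_tail(1) upper_tail_equal sum_deriv(1); assumption)+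

  show ?thesis
    by (intro conjI) (rule impI, fact lower_symmetric, rule impI, fact lower_asymmetric,
        fact upper_general, fact upper_particular)
qed

end
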